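(* Suppose the stage problem described in the context is convex. Let the continuation function be approximated from below by $\widehat Q_{t+1}(S)=\max_{\ell\in\mathcal C_{t+1}}\{a_{t\ell}+b_{t\ell}S\}$, and suppose that at the evaluated storage state $S$ there is a unique active cut $\ell^*$, i.e. $\ell^*$ is the unique index in $\mathcal C_{t+1}$ with $a_{t\ell^*}+b_{t\ell^*}S=\widehat Q_{t+1}(S)$. Then the local marginal value $\lambda_t^W$ of an additional unit of stored energy at $S$ is $$\lambda_t^W=-b_{t\ell^*}.$$ Equivalently, $-b_{t\ell^*}$ is the shadow reduction in optimal future cost associated with increasing storage, i.e. $\lambda_t^W=-\frac{d}{dS}\widehat Q_{t+1}(S)=-b_{t\ell^*}$.
   Context: Stage problem: $S_t$ is stored energy, $q_{tk}$ the inflow in scenario $k$ with probability $p_k\ge 0$ ($\sum_k p_k=1$), $u_t$ turbine release, $w_t$ spill, $g_t$ thermal backstop generation, $z_t$ unserved energy, $d_t$ demand, $\eta$ a conversion coefficient, $\gamma$ a discount factor, and $c_g,c_z,c_w$ unit costs. The risk-neutral stage problem is $$Q_t(S_t)=\min_{u_t,w_t,g_t,z_t}\; c_g g_t+c_z z_t+c_w w_t+\gamma\sum_k p_k Q_{t+1}(S_{t+1,k})$$ subject to $S_{t+1,k}=S_t+q_{tk}-u_t-w_t$, $0\le S_{t+1,k}\le S_{\max}$, $0\le u_t\le U_{\max}$, $\eta u_t+g_t+z_t=d_t$, and $g_t,z_t,w_t\ge 0$. The continuation function $Q_{t+1}$ is approximated from below by finitely many affine cuts $S\mapsto a_{t\ell}+b_{t\ell}S$,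 indexed by the finite set $\mathcal C_{t+1}$, through $\widehat Q_{t+1}(S)=\max_{\ell\in\mathcal C_{t+1}}\{a_{t\ell}+b_{t\ell}S\}$. A cut is active at $S$ if it attains this maximum. The (local) marginal value of stored energy, or water value, is the marginal reduction in future cost, as represented by the cut approximation $\widehat Q_{t+1}$, per additional unit of stored energy, i.e. $-\frac{d}{dS}\widehat Q_{t+1}(S)$. *)

theory Defs
  imports "HOL-Analysis.Analysis"
begin

record 'k storage_problem =
  scenarios :: "'k set"
  prob :: "'k \<Rightarrow> real"
  inflow :: "nat \<Rightarrow> 'k \<Rightarrow> real"
  demand :: "nat \<Rightarrow> real"
  S_max :: real
  U_max :: real
  conversion :: real
  discount :: real
  cost_thermal :: real
  cost_unserved :: real
  cost_spill :: real

text \<open>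
  A decision is a tuple \<open>(u, w, g, z)\<close>: turbine release, spill, thermal backstop generation,
  unserved energy. It is chosen before the inflow scenario is known, so the storage bounds are
  imposed in every scenario.
\<close>

type_synonym decision = "real \<times> real \<times> real \<times> real"

definition next_storage ::
    "'k storage_problem \<Rightarrow> nat \<Rightarrow> real \<Rightarrow> decision \<Rightarrow> 'k \<Rightarrow> real" where
  "next_storage P t S = (\<lambda>(u, w, g, z) k. S + inflow P t k - u - w)"

definition feasible_decisions :: "'k storage_problem \<Rightarrow> nat \<Rightarrow> real \<Rightarrow> decision set" where
  "feasible_decisions P t S =
     {(u, w, g, z).
        (\<forall>k\<in>scenarios P. 0 \<le> next_storage P t S (u, w, g, z) k
                       \<and> next_storage P t S (u, w, g, z) k \<le> S_max P) \<and>
        0 \<le> u \<and> u \<le> U_max P \<and>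
        conversion P * u + g + z = demand P t \<and>
        0 \<le> g \<and> 0 \<le> z \<and> 0 \<le> w}"

text \<open>
  Cost-to-go functions are extended-real valued, because a storage state may admit no feasible
  decision; its cost-to-go is then \<open>\<infinity>\<close>, the infimum of the empty set.
\<close>

definition stage_cost ::
    "'k storage_problem \<Rightarrow> nat \<Rightarrow> (real \<Rightarrow> ereal) \<Rightarrow> real \<Rightarrow> decision \<Rightarrow> ereal" where
  "stage_cost P t V S = (\<lambda>(u, w, g, z).
     ereal (cost_thermal P * g + cost_unserved P * z + cost_spill P * w)
     + ereal (discount P)
       * (\<Sum>k\<in>scenarios P. ereal (prob P k) * V (next_storage P t S (u, w, g, z) k)))"

definition stage_value ::
    "'k storage_problem \<Rightarrow> nat \<Rightarrow> (real \<Rightarrow> ereal) \<Rightarrow> real \<Rightarrow> ereal" where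
  "stage_value P t V S = (INF x\<in>feasible_decisions P t S. stage_cost P t V S x)"

text \<open>
  A convex objective over a convex feasible set, for every admissible incoming storage state.
  Convexity of the extended-real objective is convexity of its epigraph, since
  \<^const>\<open>convex_on\<close> covers real-valued functions only.
\<close>

definition convex_stage_problem ::
    "'k storage_problem \<Rightarrow> nat \<Rightarrow> (real \<Rightarrow> ereal) \<Rightarrow> bool" where
  "convex_stage_problem P t V \<longleftrightarrow>
     (\<forall>S\<in>{0..S_max P}.
        convex (feasible_decisions P t S) \<and>
        convex {(x, r :: real). x \<in> feasible_decisions P t S \<and> stage_cost P t V S x \<le> ereal r})"

definition cut_approx :: "'l set \<Rightarrow> ('l \<Rightarrow> real) \<Rightarrow> ('l \<Rightarrow> real) \<Rightarrow> real \<Rightarrow> real" where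
  "cut_approx C a b S = (MAX l\<in>C. a l + b l * S)"

definition active_cut ::
    "'l set \<Rightarrow> ('l \<Rightarrow> real) \<Rightarrow> ('l \<Rightarrow> real) \<Rightarrow> real \<Rightarrow> 'l \<Rightarrow> bool" where
  "active_cut C a b S l \<longleftrightarrow> l \<in> C \<and> a l + b l * S = cut_approx C a b S"

text \<open>
  Meaningful only where the cut approximation is differentiable, since \<^const>\<open>deriv\<close> is
  unspecified elsewhere.
\<close>

definition water_value :: "'l set \<Rightarrow> ('l \<Rightarrow> real) \<Rightarrow> ('l \<Rightarrow> real) \<Rightarrow> real \<Rightarrow> real" where
  "water_value C a b S = - deriv (cut_approx C a b) S"

end

theory Submission imports Defs
begin

text \<open>
  A uniquely active cut lies strictly above the finitely many others at \<open>S\<close>, hence, by continuity,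
  on a neighbourhood of \<open>S\<close>. There the cut approximation is that affine cut and has its slope.
\<close>

text \<open>Finiteness lets the maximum be traded for finitely many affine inequalities, which can
  be transported from \<open>S\<close> to nearby states.\<close>

lemma active_cut_iff:
  assumes "finite C"
  shows "active_cut C a b S l \<longleftrightarrow> l \<in> C \<and> (\<forall>l'\<in>C. a l' + b l' * S \<le> a l + b l * S)"
  using assms unfolding active_cut_def cut_approx_def
  by (auto intro!: Max_eqI[symmetric])

lemma has_real_derivative_cut_approx:
  assumes fin: "finite C"
    and act: "active_cut C a b S l"
    and uniq: "\<And>l'. active_cut C a b S l' \<Longrightarrow> l' = l"
  shows "(cut_approx C a b has_real_derivative b l) (at S)"
proof -
  have less: "a l' + b l' * S < a l + b l * S" if "l' \<in> C" "l' \<noteq> l" for l'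
  proof (rule ccontr)
    assume "\<not> ?thesis"
    \<comment> \<open>A cut reaching the height of the maximal cut \<open>l\<close> dominates all
      cuts, so it would be active too.\<close>
    with act fin that have "active_cut C a b S l'"
      by (fastforce simp: active_cut_iff)
    with uniq that show False by blast
  qed
  \<comment> \<open>The filter \<open>nhds S\<close> includes \<open>S\<close> itself, where the
    functions must also agree for their derivatives to be exchanged. The weak inequality admits
    \<open>l' = l\<close>.\<close>
  have "\<forall>\<^sub>F s in nhds S. a l' + b l' * s \<le> a l + b l * s" if "l' \<in> C" for l'
  proof (cases "l' = l")
    case False
    have "((\<lambda>s. (a l + b l * s) - (a l' + b l' * s)) \<longlongrightarrow> (a l + b l * S) - (a l' + b l' * S)) (nhds S)"
      by (intro tendsto_intros filterlim_ident)
    moreover have "(a l + b l * S) - (a l' + b l' * S) > 0"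
      using less[OF that False] by simp
    ultimately have "\<forall>\<^sub>F s in nhds S. (a l + b l * s) - (a l' + b l' * s) > 0"
      by (rule order_tendstoD(1))
    then show ?thesis
      by eventually_elim simp
  qed simp
  \<comment> \<open>Finitely many neighbourhoods, one per cut, have a common one.\<close>
  with fin have "\<forall>\<^sub>F s in nhds S. \<forall>l'\<in>C. a l' + b l' * s \<le> a l + b l * s"
    by (simp add: eventually_ball_finite_distrib)
  then have "\<forall>\<^sub>F s in nhds S. cut_approx C a b s = a l + b l * s"
  proof eventually_elim
    case (elim s)
    with act fin have "active_cut C a b s l"
      by (simp add: active_cut_iff)
    then show ?case
      by (simp add: active_cut_def)
  qed
  moreover have "((\<lambda>s. a l + b l * s) has_real_derivative b l) (at S)"
    by (auto intro!: derivative_eq_intros)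
  ultimately show ?thesis
    by (simp add: DERIV_cong_ev)
qed

theorem proposition2:
  fixes P :: "'k storage_problem"
    and Q :: "nat \<Rightarrow> real \<Rightarrow> ereal"
    and C :: "nat \<Rightarrow> 'l set"
    and a b :: "nat \<Rightarrow> 'l \<Rightarrow> real"
    and t :: nat and S :: real and l :: 'l
  assumes "finite (scenarios P)"
    and "\<And>k. k \<in> scenarios P \<Longrightarrow> prob P k \<ge> 0"
    and "(\<Sum>k\<in>scenarios P. prob P k) = 1"
    and "\<And>s. Q t s = stage_value P t (Q (Suc t)) s"
    and "convex_stage_problem P t (Q (Suc t))"
    and "finite (C (Suc t))"
    and "\<And>s. 0 \<le> s \<Longrightarrow> s \<le> S_max P \<Longrightarrow>
           ereal (cut_approx (C (Suc t)) (a t) (b t) s) \<le> Q (Suc t) s"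
    and "active_cut (C (Suc t)) (a t) (b t) S l"
    and "\<And>l'. active_cut (C (Suc t)) (a t) (b t) S l' \<Longrightarrow> l' = l"
  shows "(cut_approx (C (Suc t)) (a t) (b t) has_real_derivative b t l) (at S)
       \<and> water_value (C (Suc t)) (a t) (b t) S = - b t l
       \<and> ((\<lambda>h. (cut_approx (C (Suc t)) (a t) (b t) S
                 - cut_approx (C (Suc t)) (a t) (b t) (S + h)) / h)
            \<longlongrightarrow> - b t l) (at 0)"
proof (intro conjI)
  let ?f = "cut_approx (C (Suc t)) (a t) (b t)"
  show deriv: "(?f has_real_derivative b t l) (at S)"
    using assms by (intro has_real_derivative_cut_approx)
  \<comment> \<open>Existence of the derivative pins down the value chosen by
    \<open>deriv\<close>.\<close>
  then show "water_value (C (Suc t)) (a t) (b t) S = - b t l"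
    by (simp add: water_value_def DERIV_imp_deriv)
  \<comment> \<open>The cost reduction per unit of added storage is the negated difference quotient;
    the limit is two-sided, so it covers adding and withdrawing energy.\<close>
  have "((\<lambda>h. - ((?f (S + h) - ?f S) / h)) \<longlongrightarrow> - b t l) (at 0)"
    using deriv by (intro tendsto_minus) (simp add: DERIV_def)
  then show "((\<lambda>h. (?f S - ?f (S + h)) / h) \<longlongrightarrow> - b t l) (at 0)"
    by (simp add: minus_divide_left)
qed

end
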